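(* Let $2\le k\le n-2$. Every combinatorial $(n,k)$-hypersimplex is (i) $F$-generic if $2k<n+2$, and (ii) $G$-generic if $2k>n-2$. In particular, every combinatorial $(n,k)$-hypersimplex is $FG$-generic for $n-2<2k<n+2$.
   Context: For integers $0<k<n$, $\Delta_{n,k}=\mathrm{conv}\{x\in\{0,1\}^n : x_1+\cdots+x_n=k\}$. For $2\le k\le n-2$ its facets are exactly the $2n$ faces $F_i=\Delta_{n,k}\cap\{x_i=0\}\cong\Delta_{n-1,k}$ and $G_i=\Delta_{n,k}\cap\{x_i=1\}\cong\Delta_{n-1,k-1}$, $i=1,\dots,n$. A combinatorial $(n,k)$-hypersimplex is a polytope $P$ (regarded as full-dimensional in $\mathbb{R}^{n-1}$) together with an isomorphism of its face lattice with that of $\Delta_{n,k}$; the facets of $P$ corresponding to the $F_i$ (resp. $G_i$) are called its $F$-facets (resp. $G$-facets). $P$ is $G$-generic if the $n$ hyperplanes in $\mathbb{R}^{n-1}$ supporting the $G$-facets are not projectively concurrent, i.e. they have no common point and are not all parallel to a common line. $F$-generic is defined likewise with the $F$-facets, and $P$ is $FG$-generic if it is both $F$-generic and $G$-generic. *)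

theory Defs
  imports "HOL-Analysis.Analysis"
begin

text \<open>Throughout, \<open>n\<close> is the cardinality of the finite index type \<open>'n\<close>.\<close>

definition hypersimplex :: "nat \<Rightarrow> (real ^ 'n) set" where
  "hypersimplex k =
     convex hull {x. (\<forall>i. x $ i \<in> {0, 1}) \<and> (\<Sum>i\<in>UNIV. x $ i) = real k}"

definition hypersimplex_F :: "nat \<Rightarrow> 'n \<Rightarrow> (real ^ 'n) set" where
  "hypersimplex_F k i = hypersimplex k \<inter> {x. x $ i = 0}"

definition hypersimplex_G :: "nat \<Rightarrow> 'n \<Rightarrow> (real ^ 'n) set" where
  "hypersimplex_G k i = hypersimplex k \<inter> {x. x $ i = 1}"

text \<open>
  The faces in the sense of \<^const>\<open>face_of\<close> include the empty set and the polytope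
  itself, so \<open>{F. F face_of P}\<close>, ordered by inclusion, is the full face lattice of \<open>P\<close>.
\<close>

definition face_lattice_iso ::
  "('a::euclidean_space set \<Rightarrow> 'b::euclidean_space set) \<Rightarrow> 'a set \<Rightarrow> 'b set \<Rightarrow> bool" where
  "face_lattice_iso \<phi> Q P \<longleftrightarrow>
     bij_betw \<phi> {F. F face_of Q} {F. F face_of P} \<and>
     (\<forall>F F'. F face_of Q \<longrightarrow> F' face_of Q \<longrightarrow> (F \<subseteq> F' \<longleftrightarrow> \<phi> F \<subseteq> \<phi> F'))"

text \<open>
  A combinatorial \<open>(n,k)\<close>-hypersimplex is the pair of \<open>P\<close> and the isomorphism \<open>\<phi>\<close>;
  \<open>'a\<close> plays the role of the ambient space of dimension \<open>n - 1\<close>, in which \<open>P\<close> is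
  full-dimensional.
\<close>

definition combinatorial_hypersimplex ::
  "nat \<Rightarrow> ((real ^ 'n) set \<Rightarrow> 'a::euclidean_space set) \<Rightarrow> 'a set \<Rightarrow> bool" where
  "combinatorial_hypersimplex k \<phi> P \<longleftrightarrow>
     DIM('a) + 1 = CARD('n) \<and> polytope P \<and> aff_dim P = int DIM('a) \<and>
     face_lattice_iso \<phi> (hypersimplex k) P"

definition projectively_concurrent :: "'a::euclidean_space set set \<Rightarrow> bool" where
  "projectively_concurrent \<H> \<longleftrightarrow>
     (\<exists>p. \<forall>H\<in>\<H>. p \<in> H) \<or>
     (\<exists>v. v \<noteq> 0 \<and> (\<forall>H\<in>\<H>. \<forall>x\<in>H. \<forall>t. x + t *\<^sub>R v \<in> H))"

text \<open>
  As \<open>P\<close> is full-dimensional, the hyperplane supporting a facet of \<open>P\<close> is the affine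
  hull of that facet.
\<close>

definition F_generic ::
  "nat \<Rightarrow> ((real ^ 'n) set \<Rightarrow> 'a::euclidean_space set) \<Rightarrow> bool" where
  "F_generic k \<phi> \<longleftrightarrow>
     \<not> projectively_concurrent (range (\<lambda>i. affine hull \<phi> (hypersimplex_F k i)))"

definition G_generic ::
  "nat \<Rightarrow> ((real ^ 'n) set \<Rightarrow> 'a::euclidean_space set) \<Rightarrow> bool" where
  "G_generic k \<phi> \<longleftrightarrow>
     \<not> projectively_concurrent (range (\<lambda>i. affine hull \<phi> (hypersimplex_G k i)))"

definition FG_generic ::
  "nat \<Rightarrow> ((real ^ 'n) set \<Rightarrow> 'a::euclidean_space set) \<Rightarrow> bool" where
  "FG_generic k \<phi> \<longleftrightarrow> F_generic k \<phi> \<and> G_generic k \<phi>"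

end

theory Submission
  imports Defs
begin

text \<open>
  If the supporting hyperplanes of the faces \<open>F\<^sub>i\<close> are projectively concurrent, then the \<open>n\<close>
  affine slack functions \<open>s\<^sub>i\<close> on the \<open>(n - 1)\<close>-dimensional space satisfy a nontrivial linear
  relation \<open>\<Sum>\<^sub>i \<lambda>\<^sub>i s\<^sub>i = 0\<close>. At the vertex corresponding to a \<open>k\<close>-set \<open>S\<close> the positive slacks are
  those with \<open>i \<in> S\<close>, so \<open>S\<close> meets \<open>{i. \<lambda>\<^sub>i > 0}\<close> iff it meets \<open>{i. \<lambda>\<^sub>i < 0}\<close>. Hence both of
  these sets have complements with fewer than \<open>k\<close> elements, which forces \<open>n \<le> 2 k - 2\<close>.
  For the \<open>G\<close>-facets the same argument applies with \<open>S\<close> replaced by its complement.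
\<close>

text \<open>If \<open>- B\<close> had at least \<open>m\<close> elements, some \<open>m\<close>-set
  inside it would contain a chosen point of \<open>A\<close>, meeting \<open>A\<close> but not
  \<open>B\<close>. So \<open>- B\<close>, and by symmetry \<open>- A\<close>, has at most
  \<open>m - 1\<close> elements; as \<open>A\<close> and \<open>B\<close> are disjoint, these
  complements cover the whole type.\<close>

lemma meeting_sets_card_bound:
  fixes A B :: "'n::finite set"
  assumes "A \<noteq> {}" and "A \<inter> B = {}" and "1 \<le> m" and "m \<le> CARD('n)"
    and AB: "\<And>T. card T = m \<Longrightarrow> T \<inter> A \<noteq> {} \<longleftrightarrow> T \<inter> B \<noteq> {}"
  shows "CARD('n) + 2 \<le> 2 * m"
proof -
  have small: "card (- Y) < m"
    if "X \<noteq> {}" "X \<inter> Y = {}"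
      and XY: "\<And>T. card T = m \<Longrightarrow> T \<inter> X \<noteq> {} \<Longrightarrow> T \<inter> Y \<noteq> {}" for X Y :: "'n set"
  proof (rule ccontr)
    assume "\<not> card (- Y) < m"
    obtain x where x: "x \<in> X" using \<open>X \<noteq> {}\<close> by blast
    then have "{x} \<subseteq> - Y" using \<open>X \<inter> Y = {}\<close> by blast
    then obtain T where T: "{x} \<subseteq> T" "T \<subseteq> - Y" "card T = m"
      using exists_subset_between[of "{x}" m "- Y"] \<open>1 \<le> m\<close> \<open>\<not> card (- Y) < m\<close> by auto
    then show False using XY[of T] x by blast
  qed
  have B: "card (- B) < m" using small[of A B] assms(1,2) AB by blast
  \<comment> \<open>The roles of \<open>A\<close> and \<open>B\<close> can be swapped only once
    \<open>B\<close> is known to have a point; for empty \<open>B\<close> the complement would have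
    at least \<open>m\<close> elements.\<close>
  then have "B \<noteq> {}" using \<open>m \<le> CARD('n)\<close> by auto
  then have A: "card (- A) < m" using small[of B A] assms(2) AB by blast
  have "CARD('n) = card (- A \<union> - B)" using assms(2) by (metis Compl_Int Compl_empty_eq)
  also have "\<dots> \<le> card (- A) + card (- B)" by (rule card_Un_le)
  finally show ?thesis using A B by linarith
qed

text \<open>After homogenizing, a common point \<open>p\<close> or a common direction
  \<open>v\<close> becomes a nonzero vector \<open>(p, -1)\<close> or \<open>(v, 0)\<close>
  orthogonal to all \<open>n\<close> vectors \<open>(a i, b i)\<close>. These lie in a space of
  dimension \<open>n\<close> and do not span it, so they are linearly dependent.\<close>

lemma concurrent_imp_linear_relation:
  fixes a :: "'n::finite \<Rightarrow> 'a::euclidean_space" and b :: "'n \<Rightarrow> real"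
  assumes dim: "DIM('a) + 1 = CARD('n)"
    and ne: "\<And>i. C i \<noteq> {}"
    and sub: "\<And>i. C i \<subseteq> {x. a i \<bullet> x = b i}"
    and conc: "projectively_concurrent (range C)"
  obtains l where "l \<noteq> (0 :: real ^ 'n)" and "\<And>x. (\<Sum>i\<in>UNIV. l $ i * (b i - a i \<bullet> x)) = 0"
proof -
  obtain w :: "'a \<times> real" where w: "w \<noteq> 0" "\<And>i. (a i, b i) \<bullet> w = 0"
  proof -
    consider p where "\<And>i. p \<in> C i"
      | v where "v \<noteq> 0" "\<And>i x t. x \<in> C i \<Longrightarrow> x + t *\<^sub>R v \<in> C i"
      using conc unfolding projectively_concurrent_def ball_simps by metis
    then show thesis
    proof cases
      case 1
      then have "a i \<bullet> p = b i" for i using sub[of i] by auto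
      then show thesis by (intro that[of "(p, -1)"]) (simp_all add: zero_prod_def)
    next
      case 2
      have "a i \<bullet> v = 0" for i
      proof -
        obtain x where x: "x \<in> C i" using ne by blast
        then have "a i \<bullet> (x + 1 *\<^sub>R v) = b i" "a i \<bullet> x = b i" 
          using 2(2)[OF x, of 1] x sub[of i] by auto
        then show ?thesis by (simp add: inner_add_right)
      qed
      then show thesis using \<open>v \<noteq> 0\<close> by (intro that[of "(v, 0)"]) (simp_all add: zero_prod_def)
    qed
  qed
  define L where "L = (\<lambda>l :: real ^ 'n. \<Sum>i\<in>UNIV. l $ i *\<^sub>R (a i, b i))"
  have L: "linear L" unfolding L_def
    by (intro linearI) (simp_all add: scaleR_add_left sum.distrib scaleR_sum_right del: scaleR_Pair)
  have orth: "L l \<bullet> w = 0" for l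
    unfolding L_def by (simp add: inner_sum_left w(2) del: scaleR_Pair)
  have "\<not> surj L"
  proof
    assume "surj L"
    then obtain l where "L l = w" by (metis surjD)
    then show False using orth[of l] w(1) by simp
  qed
  moreover have "dim (UNIV :: ('a \<times> real) set) = dim (UNIV :: (real ^ 'n) set)"
    using dim by simp
  ultimately have "\<not> inj L"
    using linear_injective_imp_surjective[OF L] by blast
  then obtain l where l: "l \<noteq> 0" "L l = 0"
    using linear_injective_0[OF L] by blast
  \<comment> \<open>Pairing \<open>(a i, b i)\<close> with \<open>(- x, 1)\<close> gives the slack
    at \<open>x\<close>, so the dependence of the vectors becomes one of the slack
    functions.\<close>
  have "(\<Sum>i\<in>UNIV. l $ i * (b i - a i \<bullet> x)) = L l \<bullet> (- x, 1)" for x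
    unfolding L_def by (simp add: inner_sum_left algebra_simps)
  then show thesis using that[of l] l by simp
qed

text \<open>Stated for an abstract family \<open>H\<close> so that it serves both facet families:
  \<open>m = k\<close> for the \<open>F\<close>-facets and \<open>m = n - k\<close> for the
  \<open>G\<close>-facets. The face \<open>E\<close> stands for a vertex, and \<open>T\<close>
  indexes the members of \<open>H\<close> that do not contain it.\<close>

lemma face_lattice_iso_not_concurrent:
  fixes H :: "'n::finite \<Rightarrow> 'b::euclidean_space set" and P :: "'a::euclidean_space set"
  assumes dim: "DIM('a) + 1 = CARD('n)" and P: "polytope P"
    and iso: "face_lattice_iso \<phi> Q P"
    and H: "\<And>i. H i face_of Q"
    and m: "1 \<le> m" "m < CARD('n)" "2 * m < CARD('n) + 2"
    and E: "\<And>T. card T = m \<Longrightarrow> \<exists>E. E face_of Q \<and> E \<noteq> {} \<and> (\<forall>i. E \<subseteq> H i \<longleftrightarrow> i \<notin> T)"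
  shows "\<not> projectively_concurrent (range (\<lambda>i. affine hull \<phi> (H i)))"
proof
  assume conc: "projectively_concurrent (range (\<lambda>i. affine hull \<phi> (H i)))"
  have face: "\<phi> F face_of P" if "F face_of Q" for F
    using iso that unfolding face_lattice_iso_def bij_betw_def by blast
  have mono: "F \<subseteq> F' \<longleftrightarrow> \<phi> F \<subseteq> \<phi> F'" if "F face_of Q" "F' face_of Q" for F F'
    using iso that unfolding face_lattice_iso_def by blast
  have nonempty: "\<phi> F \<noteq> {}" if "F face_of Q" "F \<noteq> {}" for F
    using mono[OF that(1) empty_face_of] that(2) by auto
  \<comment> \<open>Faces of a polyhedron are exposed, so each \<open>H i\<close> yields a slack
    \<open>b i - a i \<bullet> x\<close> that is nonnegative on \<open>P\<close> and vanishes there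
    exactly on \<open>\<phi> (H i)\<close>.\<close>
  have "\<exists>a b. P \<subseteq> {x. a \<bullet> x \<le> b} \<and> \<phi> (H i) = P \<inter> {x. a \<bullet> x = b}" for i
    using face[OF H[of i]] exposed_face_of_polyhedron[OF polytope_imp_polyhedron[OF P]]
    unfolding exposed_face_of_def by blast
  then obtain a b where le: "\<And>i. P \<subseteq> {x. a i \<bullet> x \<le> b i}"
    and eq: "\<And>i. \<phi> (H i) = P \<inter> {x. a i \<bullet> x = b i}"
    by metis
  have "H i \<noteq> {}" for i
  proof -
    have "m \<le> card (- {i})" using m by (simp add: Compl_eq_Diff_UNIV card_Diff_subset)
    then obtain T where "T \<subseteq> - {i}" "card T = m" by (meson obtain_subset_with_card_n)
    then show ?thesis using E[of T] by blast
  qed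
  then have ne: "affine hull \<phi> (H i) \<noteq> {}" for i
    using nonempty[OF H] by simp
  have sub: "affine hull \<phi> (H i) \<subseteq> {x. a i \<bullet> x = b i}" for i
    by (rule hull_minimal) (auto simp: eq affine_hyperplane)
  obtain l where l: "l \<noteq> (0 :: real ^ 'n)"
    and rel: "\<And>x. (\<Sum>i\<in>UNIV. l $ i * (b i - a i \<bullet> x)) = 0"
    using concurrent_imp_linear_relation[OF dim ne sub conc] by blast
  have slack: "\<exists>s. (\<forall>i\<in>T. s i > 0) \<and> (\<forall>i. i \<notin> T \<longrightarrow> s i = 0) \<and> (\<Sum>i\<in>UNIV. l $ i * s i) = 0"
    if T: "card T = m" for T
  proof -
    obtain E where E: "E face_of Q" "E \<noteq> {}" "\<And>i. E \<subseteq> H i \<longleftrightarrow> i \<notin> T"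
      using E[OF T] by blast
    \<comment> \<open>A relative interior point of \<open>\<phi> E\<close> lies in a face of
      \<open>P\<close> only if all of \<open>\<phi> E\<close> does. Inclusions in the face lattice
      thus determine which slacks vanish at that point.\<close>
    have "rel_interior (\<phi> E) \<noteq> {}"
      using rel_interior_eq_empty[OF face_of_imp_convex[OF face[OF E(1)]]] nonempty[OF E(1,2)]
      by simp
    then obtain x where x: "x \<in> rel_interior (\<phi> E)" by blast
    then have "x \<in> P"
      using rel_interior_subset face_of_imp_subset[OF face[OF E(1)]] by blast
    have "x \<in> \<phi> (H i) \<longleftrightarrow> i \<notin> T" for i
    proof -
      have "x \<in> \<phi> (H i) \<longleftrightarrow> \<phi> E \<subseteq> \<phi> (H i)"
        using subset_of_face_of[OF face[OF H] face_of_imp_subset[OF face[OF E(1)]], of i] x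
          rel_interior_subset by blast
      then show ?thesis using mono[OF E(1) H] E(3) by blast
    qed
    then have "a i \<bullet> x = b i \<longleftrightarrow> i \<notin> T" for i using \<open>x \<in> P\<close> eq by blast
    moreover have "a i \<bullet> x \<le> b i" for i using \<open>x \<in> P\<close> le by blast
    ultimately show ?thesis
      using rel[of x]
      by (intro exI[of _ "\<lambda>i. b i - a i \<bullet> x"])
        (metis diff_gt_0_iff_gt order_less_le right_minus_eq)
  qed
  \<comment> \<open>\<open>A c\<close> collects the indices where \<open>l\<close> has the sign of
    \<open>c\<close>; keeping \<open>c\<close> as a parameter lets one argument treat both
    signs.\<close>
  define A where "A = (\<lambda>c :: real. {i. c * l $ i > 0})"
  have meet: "T \<inter> A (- c) \<noteq> {}" if T: "card T = m" and ne: "T \<inter> A c \<noteq> {}" for c T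
  proof
    assume emp: "T \<inter> A (- c) = {}"
    obtain s where s: "\<And>i. i \<in> T \<Longrightarrow> s i > 0" "\<And>i. i \<notin> T \<Longrightarrow> s i = 0"
      "(\<Sum>i\<in>UNIV. l $ i * s i) = 0" using slack[OF T] by blast
    obtain j where j: "j \<in> T" "c * l $ j > 0" using ne A_def by blast
    \<comment> \<open>If \<open>T\<close> misses \<open>A (- c)\<close>, no term is negative, and
      the term at \<open>j\<close> is positive, against the linear relation.\<close>
    have "(\<Sum>i\<in>UNIV. c * l $ i * s i) > 0"
    proof (rule sum_pos2[of _ j])
      fix i
      show "0 \<le> c * l $ i * s i"
      proof (cases "i \<in> T")
        case True
        then have "c * l $ i \<ge> 0" using emp unfolding A_def by force
        then show ?thesis using s(1)[OF True] by simp
      qed (simp add: s(2))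
    qed (use j s(1) in auto)
    moreover have "(\<Sum>i\<in>UNIV. c * l $ i * s i) = c * (\<Sum>i\<in>UNIV. l $ i * s i)"
      by (simp add: sum_distrib_left mult.assoc)
    ultimately show False using s(3) by simp
  qed
  obtain j where "l $ j \<noteq> 0" using l by (auto simp: vec_eq_iff)
  \<comment> \<open>Taking \<open>c = l $ j\<close> makes \<open>A c\<close> nonempty whatever the
    sign of \<open>l $ j\<close>.\<close>
  then have "j \<in> A (l $ j)"
    unfolding A_def by (simp add: zero_less_mult_iff linorder_neq_iff disj_commute)
  moreover have "A (l $ j) \<inter> A (- (l $ j)) = {}" unfolding A_def by auto
  ultimately have "CARD('n) + 2 \<le> 2 * m"
    using meeting_sets_card_bound[of "A (l $ j)" "A (- (l $ j))" m] m
      meet[of _ "l $ j"] meet[of _ "- (l $ j)"] by auto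
  then show False using m by simp
qed

lemma hypersimplex_coord:
  fixes x :: "real ^ 'n"
  assumes "x \<in> hypersimplex k"
  shows "0 \<le> x $ i" and "x $ i \<le> 1"
proof -
  have "hypersimplex k \<subseteq> {x :: real ^ 'n. 0 \<le> x $ i \<and> x $ i \<le> 1}"
    unfolding hypersimplex_def
  proof (rule hull_minimal)
    have "convex ({x :: real ^ 'n. 0 \<le> x $ i} \<inter> {x. x $ i \<le> 1})"
      by (intro convex_Int) (simp_all add: convex_def algebra_simps convex_bound_le)
    then show "convex {x :: real ^ 'n. 0 \<le> x $ i \<and> x $ i \<le> 1}"
      by (simp add: Collect_conj_eq)
    show "{x :: real ^ 'n. (\<forall>i. x $ i \<in> {0, 1}) \<and> (\<Sum>i\<in>UNIV. x $ i) = real k}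
        \<subseteq> {x. 0 \<le> x $ i \<and> x $ i \<le> 1}"
    proof clarify
      fix x :: "real ^ 'n" assume "\<forall>i. x $ i \<in> {0, 1}"
      then have "x $ i \<in> {0, 1}" by blast
      then show "0 \<le> x $ i \<and> x $ i \<le> 1" by auto
    qed
  qed
  then show "0 \<le> x $ i" "x $ i \<le> 1" using assms by auto
qed

lemma
  fixes i :: "'n::finite"
  shows hypersimplex_F_face: "hypersimplex_F k i face_of hypersimplex k"
    and hypersimplex_G_face: "hypersimplex_G k i face_of hypersimplex k"
proof -
  have c: "convex (hypersimplex k :: (real ^ 'n) set)"
    unfolding hypersimplex_def by (rule convex_convex_hull)
  have i: "x $ i = axis i 1 \<bullet> x" for x :: "real ^ 'n"
    by (simp add: inner_axis')
  show "hypersimplex_F k i face_of hypersimplex k"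
    unfolding hypersimplex_F_def i
    by (rule face_of_Int_supporting_hyperplane_ge[OF c])
      (simp add: i[symmetric] hypersimplex_coord)
  show "hypersimplex_G k i face_of hypersimplex k"
    unfolding hypersimplex_G_def i
    by (rule face_of_Int_supporting_hyperplane_le[OF c])
      (simp add: i[symmetric] hypersimplex_coord)
qed

lemma hypersimplex_vertex_face:
  fixes S :: "'n::finite set"
  assumes "card S = k"
  defines "e \<equiv> (\<chi> i. of_bool (i \<in> S)) :: real ^ 'n"
  shows "{e} face_of hypersimplex k"
    and "{e} \<subseteq> hypersimplex_F k i \<longleftrightarrow> i \<notin> S"
    and "{e} \<subseteq> hypersimplex_G k i \<longleftrightarrow> i \<in> S"
proof -
  have mem: "e \<in> hypersimplex k"
    unfolding hypersimplex_def e_def using assms(1) by (intro hull_inc) simp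
  show "{e} \<subseteq> hypersimplex_F k i \<longleftrightarrow> i \<notin> S" "{e} \<subseteq> hypersimplex_G k i \<longleftrightarrow> i \<in> S"
    using mem by (auto simp: hypersimplex_F_def hypersimplex_G_def e_def)
  \<comment> \<open>The vertex is the intersection of one face \<open>F\<close> or \<open>G\<close>
    per index, since together these prescribe every coordinate.\<close>
  let ?\<F> = "range (\<lambda>i. if i \<in> S then hypersimplex_G k i else hypersimplex_F k i)"
  have "\<Inter> ?\<F> face_of hypersimplex k"
    by (rule face_of_Inter) (auto simp: hypersimplex_F_face hypersimplex_G_face)
  moreover have "\<Inter> ?\<F> = {e}"
  proof
    show "\<Inter> ?\<F> \<subseteq> {e}"
    proof
      fix x assume x: "x \<in> \<Inter> ?\<F>"
      have "x $ i = e $ i" for i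
      proof -
        have "x \<in> (if i \<in> S then hypersimplex_G k i else hypersimplex_F k i)"
          using x by blast
        then show ?thesis
          by (auto simp: hypersimplex_F_def hypersimplex_G_def e_def split: if_splits)
      qed
      then show "x \<in> {e}" by (simp add: vec_eq_iff)
    qed
    show "{e} \<subseteq> \<Inter> ?\<F>"
      using mem by (auto simp: hypersimplex_F_def hypersimplex_G_def e_def)
  qed
  ultimately show "{e} face_of hypersimplex k" by simp
qed

theorem lemma4p2:
  fixes k :: nat
    and P :: "'a::euclidean_space set"
    and \<phi> :: "(real ^ 'n) set \<Rightarrow> 'a set"
  assumes "2 \<le> k" and "k + 2 \<le> CARD('n)"
    and "combinatorial_hypersimplex k \<phi> P"
  shows "(2 * k < CARD('n) + 2 \<longrightarrow> F_generic k \<phi>) \<and>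
         (2 * k + 2 > CARD('n) \<longrightarrow> G_generic k \<phi>) \<and>
         (CARD('n) < 2 * k + 2 \<and> 2 * k < CARD('n) + 2 \<longrightarrow> FG_generic k \<phi>)"
proof -
  have P: "DIM('a) + 1 = CARD('n)" "polytope P" "face_lattice_iso \<phi> (hypersimplex k) P"
    using assms(3) unfolding combinatorial_hypersimplex_def by auto
  have F: "F_generic k \<phi>" if "2 * k < CARD('n) + 2"
    unfolding F_generic_def
  proof (rule face_lattice_iso_not_concurrent[OF P hypersimplex_F_face])
    fix T :: "'n set" assume "card T = k"
    note e = hypersimplex_vertex_face[OF this]
    show "\<exists>E. E face_of hypersimplex k \<and> E \<noteq> {} \<and> (\<forall>i. E \<subseteq> hypersimplex_F k i \<longleftrightarrow> i \<notin> T)"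
      using e(1,2) by blast
  qed (use assms that in auto)
  have G: "G_generic k \<phi>" if "2 * k + 2 > CARD('n)"
    unfolding G_generic_def
  proof (rule face_lattice_iso_not_concurrent[OF P hypersimplex_G_face])
    \<comment> \<open>The \<open>G\<close>-facets missing a vertex are indexed by the complement of
      its support. With \<open>m = n - k\<close>, the condition \<open>2 * m < n + 2\<close> reads
      \<open>n < 2 * k + 2\<close>.\<close>
    fix T :: "'n set" assume "card T = CARD('n) - k"
    then have "card (- T) = k" using assms(2) by (simp add: Compl_eq_Diff_UNIV card_Diff_subset)
    note e = hypersimplex_vertex_face[OF this]
    show "\<exists>E. E face_of hypersimplex k \<and> E \<noteq> {} \<and> (\<forall>i. E \<subseteq> hypersimplex_G k i \<longleftrightarrow> i \<notin> T)"
      using e(1,3) by blast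
  qed (use assms that in auto)
  show ?thesis using F G unfolding FG_generic_def by blast
qed

end
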